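(* Let $n\ge1$ be an integer, let $L>0$, let $f:\mathbb{R}^d\to\mathbb{R}$ be convex and $L$-smooth, and let $x_\star\in\arg\min f$. Let $r\in(0,1)$ be the unique solution in $(0,1)$ of $r^n(1+n(1+r))=1$. For any $x_0\in\mathbb{R}^d$ run $$x_{i+1}=x_i-\frac{1+r}{L}\nabla f(x_i),\qquad i=0,\ldots,n-1 .$$ With $\eta=r^n=(1+n(1+r))^{-1}$, the terminal iterate satisfies $$\frac{1-\eta}{2L}\|\nabla f(x_n)\|^2+\frac{\eta^2L}{2}\|x_n-x_\star\|^2+(\eta-\eta^2)\bigl(f(x_n)-f(x_\star)\bigr)\le\frac{\eta^2L}{2}\|x_0-x_\star\|^2 .$$
   Context: $\|\cdot\|$ is the Euclidean norm. $L$-smooth means differentiable with $L$-Lipschitz gradient. *)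

theory Defs
  imports "HOL-Analysis.Analysis"
begin

definition gradient :: "(real ^ 'd \<Rightarrow> real) \<Rightarrow> real ^ 'd \<Rightarrow> real ^ 'd" where
  "gradient f x = (THE g. GDERIV f x :> g)"

lemma gradient_eq: "gradient f x = g" if "GDERIV f x :> g"
  unfolding gradient_def
proof (rule the_equality)
  show "GDERIV f x :> g" by fact
  fix h assume "GDERIV f x :> h"
  then have "(\<lambda>v. v \<bullet> h) = (\<lambda>v. v \<bullet> g)"
    using that has_derivative_unique unfolding gderiv_def by blast
  then show "h = g"
    by (metis inner_commute vector_eq_rdot)
qed

lemma differentiable_imp_GDERIV:
  fixes f :: "real ^ 'd \<Rightarrow> real"
  assumes "f differentiable (at x)"
  shows "GDERIV f x :> gradient f x"
proof -
  obtain D where D: "(f has_derivative D) (at x)"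
    using assms unfolding differentiable_def by blast
  then have lin: "linear D" by (rule has_derivative_linear)
  have "D = (\<lambda>v. v \<bullet> adjoint D 1)"
    using adjoint_works[OF lin, of _ 1] by auto
  with D have "GDERIV f x :> adjoint D 1"
    unfolding gderiv_def by metis
  then show ?thesis using gradient_eq by metis
qed

definition L_smooth :: "real \<Rightarrow> (real ^ 'd \<Rightarrow> real) \<Rightarrow> bool" where
  "L_smooth L f \<longleftrightarrow>
     (\<forall>x. f differentiable (at x)) \<and> L-lipschitz_on UNIV (gradient f)"

end

theory Submission
  imports Defs
begin

text \<open>
  Take \<open>L = 1\<close> and put \<open>h = 1 + r\<close>. Since \<open>\<eta> - \<eta>\<^sup>2 = \<eta>\<^sup>2 n h\<close>, expanding the distance to the minimizer and
  using the interpolation inequality between the minimizer and each of \<open>x\<^sub>0, \<dots>, x\<^bsub>n-1\<^esub>\<close> with the common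
  weight \<open>\<eta>\<^sup>2 h\<close> removes the minimizer and leaves
  \<open>\<Sum>i<n. f\<^sub>i - f\<^sub>n - r/2 \<parallel>g\<^sub>i\<parallel>\<^sup>2 \<ge> n / (2 \<eta>) \<parallel>g\<^sub>n\<parallel>\<^sup>2\<close>.

  With \<open>p\<^sub>i = x\<^sub>i - g\<^sub>i\<close> and \<open>k\<^sub>i = f\<^sub>i - \<parallel>g\<^sub>i\<parallel>\<^sup>2/2\<close> the interpolation inequalities become the plain subgradient
  inequalities \<open>e\<^sub>i\<^sub>j = k\<^sub>i - k\<^sub>j - \<langle>g\<^sub>j, p\<^sub>i - p\<^sub>j\<rangle> \<ge> 0\<close>, and the iteration becomes
  \<open>p\<^sub>i - p\<^bsub>i+1\<^esub> = g\<^bsub>i+1\<^esub> + r g\<^sub>i\<close>. The remaining inequality is a nonnegative combination of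
  \<open>d\<^sub>l = e\<^bsub>l,l+1\<^esub> + r e\<^bsub>l+1,l\<^esub>\<close> and
  \<open>\<Psi>\<^sub>l = e\<^sub>l\<^sub>n + r e\<^sub>n\<^sub>l + h (\<Sum>l<i<n. e\<^sub>l\<^sub>i + e\<^sub>n\<^sub>i)\<close>, in both of which all inner products of distinct
  gradients cancel. The nonnegativity of the weights comes down to Bernoulli-type inequalities
  for \<open>\<rho> = r\<^sup>-\<^sup>2\<close>, where the equation for \<open>r\<close> enters as \<open>\<rho>\<^sup>n = (1 + n h)\<^sup>2\<close>.
\<close>

section \<open>Smooth convex functions\<close>

text \<open>Restriction to the line through \<open>x\<close> and \<open>y\<close> reduces this to
  the tangent inequality for convex functions of one variable.\<close>

lemma convex_above_tangent:
  fixes f :: "real ^ 'd \<Rightarrow> real"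
  assumes cvx: "convex_on UNIV f" and D: "GDERIV f x :> g"
  shows "f x + g \<bullet> (y - x) \<le> f y"
proof -
  define \<phi> where "\<phi> t = f (x + t *\<^sub>R (y - x))" for t :: real
  have "convex_on UNIV \<phi>"
  proof (rule convex_onI)
    fix s u v :: real assume "0 < s" "s < 1"
    moreover have "x + ((1 - s) *\<^sub>R u + s *\<^sub>R v) *\<^sub>R (y - x)
        = (1 - s) *\<^sub>R (x + u *\<^sub>R (y - x)) + s *\<^sub>R (x + v *\<^sub>R (y - x))"
      by (simp add: algebra_simps)
    ultimately show "\<phi> ((1 - s) *\<^sub>R u + s *\<^sub>R v) \<le> (1 - s) * \<phi> u + s * \<phi> v"
      unfolding \<phi>_def using convex_onD[OF cvx, of s] by simp
  qed simp
  moreover have "((\<lambda>t. x + t *\<^sub>R (y - x)) has_derivative (\<lambda>t. t *\<^sub>R (y - x))) (at 0)"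
    by (auto intro!: derivative_eq_intros)
  then have "(\<phi> has_derivative (\<lambda>t. (t *\<^sub>R (y - x)) \<bullet> g)) (at 0)"
    unfolding \<phi>_def using D has_derivative_compose[of "\<lambda>t. x + t *\<^sub>R (y - x)" "\<lambda>t. t *\<^sub>R (y - x)" 0 UNIV f "\<lambda>v. v \<bullet> g"]
    by (simp add: gderiv_def)
  then have "(\<phi> has_real_derivative g \<bullet> (y - x)) (at 0)"
    unfolding has_field_derivative_def
    by (rule has_derivative_eq_rhs) (auto simp: inner_commute mult.commute)
  ultimately have "\<phi> 1 - \<phi> 0 \<ge> (g \<bullet> (y - x)) * (1 - 0)"
    by (intro convex_on_imp_above_tangent[where A = UNIV]) (auto simp: connected_UNIV)
  then show ?thesis by (simp add: \<phi>_def)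
qed

text \<open>Along the segment, \<open>f\<close> minus its tangent and minus the quadratic has
  nonpositive derivative, by Cauchy-Schwarz and the Lipschitz bound.\<close>

lemma L_smooth_descent:
  fixes f :: "real ^ 'd \<Rightarrow> real"
  assumes sm: "L_smooth L f"
  shows "f (x + v) \<le> f x + gradient f x \<bullet> v + L / 2 * (norm v)\<^sup>2"
proof -
  have D: "GDERIV f z :> gradient f z" for z
    using sm differentiable_imp_GDERIV unfolding L_smooth_def by blast
  have lip: "norm (gradient f a - gradient f b) \<le> L * norm (a - b)" for a b
    using sm unfolding L_smooth_def by (auto dest: lipschitz_onD simp: dist_norm)
  define \<phi> where "\<phi> t = f (x + t *\<^sub>R v) - t * (gradient f x \<bullet> v) - L / 2 * (norm v)\<^sup>2 * t\<^sup>2" for t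
  have "\<phi> 1 \<le> \<phi> 0"
  proof (rule DERIV_nonpos_imp_nonincreasing[OF zero_le_one])
    fix t :: real assume t: "0 \<le> t"
    have "((\<lambda>t. x + t *\<^sub>R v) has_derivative (\<lambda>t. t *\<^sub>R v)) (at t)"
      by (auto intro!: derivative_eq_intros)
    then have "((\<lambda>t. f (x + t *\<^sub>R v)) has_derivative (\<lambda>s. (s *\<^sub>R v) \<bullet> gradient f (x + t *\<^sub>R v))) (at t)"
      using D[of "x + t *\<^sub>R v"] unfolding gderiv_def by (rule has_derivative_compose)
    then have "((\<lambda>t. f (x + t *\<^sub>R v)) has_real_derivative gradient f (x + t *\<^sub>R v) \<bullet> v) (at t)"
      unfolding has_field_derivative_def
      by (rule has_derivative_eq_rhs) (auto simp: inner_commute mult.commute)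
    then have "(\<phi> has_real_derivative
        (gradient f (x + t *\<^sub>R v) - gradient f x) \<bullet> v - L * (norm v)\<^sup>2 * t) (at t)"
      unfolding \<phi>_def by (auto intro!: derivative_eq_intros simp: inner_diff_left)
    moreover have "(gradient f (x + t *\<^sub>R v) - gradient f x) \<bullet> v \<le> (L * norm (t *\<^sub>R v)) * norm v"
      using norm_cauchy_schwarz mult_right_mono[OF lip[of "x + t *\<^sub>R v" x] norm_ge_zero[of v]]
      by (smt (verit) add_diff_cancel_left')
    then have "(gradient f (x + t *\<^sub>R v) - gradient f x) \<bullet> v - L * (norm v)\<^sup>2 * t \<le> 0"
      using t by (simp add: power2_eq_square mult_ac)
    ultimately show "\<exists>y. (\<phi> has_real_derivative y) (at t) \<and> y \<le> 0" by blast
  qed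
  then show ?thesis by (simp add: \<phi>_def)
qed

text \<open>The tangent at \<open>y\<close> bounds \<open>f\<close> from below, the quadratic model
  at \<open>x\<close> from above. The two are compared at \<open>x - d / L\<close>, where their gap
  is smallest.\<close>

lemma L_smooth_convex_interpolation:
  fixes f :: "real ^ 'd \<Rightarrow> real"
  assumes "L > 0" and cvx: "convex_on UNIV f" and sm: "L_smooth L f"
  shows "f y + gradient f y \<bullet> (x - y) + (norm (gradient f x - gradient f y))\<^sup>2 / (2 * L) \<le> f x"
proof -
  define d where "d = gradient f x - gradient f y"
  have "GDERIV f y :> gradient f y"
    using sm differentiable_imp_GDERIV unfolding L_smooth_def by blast
  from convex_above_tangent[OF cvx this, of "x + (- 1 / L) *\<^sub>R d"]
  have "f y + gradient f y \<bullet> (x - y) - gradient f y \<bullet> d / L \<le> f (x + (- 1 / L) *\<^sub>R d)"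
    by (simp add: inner_diff_right inner_add_right algebra_simps)
  also have "\<dots> \<le> f x - gradient f x \<bullet> d / L + L / 2 * (norm ((- 1 / L) *\<^sub>R d))\<^sup>2"
    using L_smooth_descent[OF sm, of x "(- 1 / L) *\<^sub>R d"] by simp
  also have "L / 2 * (norm ((- 1 / L) *\<^sub>R d))\<^sup>2 = (norm d)\<^sup>2 / (2 * L)"
    using \<open>L > 0\<close> by (simp add: power_mult_distrib power2_eq_square field_simps)
  finally have "f y + gradient f y \<bullet> (x - y) + (gradient f x - gradient f y) \<bullet> d / L
      - (norm d)\<^sup>2 / (2 * L) \<le> f x"
    by (simp add: inner_diff_left diff_divide_distrib)
  also have "(gradient f x - gradient f y) \<bullet> d / L = 2 * ((norm d)\<^sup>2 / (2 * L))"
    by (simp add: d_def power2_norm_eq_inner)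
  finally show ?thesis by (simp add: d_def)
qed

text \<open>A gradient step of length \<open>1 / L\<close> lowers the value by at least
  \<open>(norm ?g)\<^sup>2 / (2 * L)\<close>, which is impossible at a minimizer unless the gradient
  is zero.\<close>

lemma L_smooth_gradient_arg_min:
  fixes f :: "real ^ 'd \<Rightarrow> real"
  assumes "L > 0" and sm: "L_smooth L f" and min: "\<And>y. f x \<le> f y"
  shows "gradient f x = 0"
proof -
  let ?g = "gradient f x"
  have "f x \<le> f (x + (- 1 / L) *\<^sub>R ?g)" by (rule min)
  also have "\<dots> \<le> f x + ?g \<bullet> ((- 1 / L) *\<^sub>R ?g) + L / 2 * (norm ((- 1 / L) *\<^sub>R ?g))\<^sup>2"
    by (rule L_smooth_descent[OF sm])
  also have "\<dots> = f x - (norm ?g)\<^sup>2 / (2 * L)"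
    using \<open>L > 0\<close> by (simp add: power2_norm_eq_inner[symmetric] power_mult_distrib power2_eq_square field_simps)
  finally show ?thesis using \<open>L > 0\<close> by (simp add: divide_le_0_iff)
qed

section \<open>The balanced ratio and the weights\<close>

text \<open>The left-hand side is \<open>0\<close> at \<open>0\<close> and \<open>1 + 2 * n\<close>
  at \<open>1\<close>, and it increases strictly on positive arguments.\<close>

lemma ex1_balanced_ratio:
  assumes "n \<ge> 1"
  shows "\<exists>!r::real. r \<in> {0<..<1} \<and> r ^ n * (1 + real n * (1 + r)) = 1"
proof (rule ex_ex1I)
  let ?F = "\<lambda>r::real. r ^ n * (1 + real n * (1 + r))"
  have "\<exists>r\<ge>0. r \<le> 1 \<and> ?F r = 1"
    using assms by (intro IVT) (auto simp: power_0_left)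
  then obtain r where r: "0 \<le> r" "r \<le> 1" "?F r = 1" by blast
  then have "r \<noteq> 0" "r \<noteq> 1" using assms by (auto simp: power_0_left)
  with r show "\<exists>r. r \<in> {0<..<1} \<and> ?F r = 1" by (intro exI[of _ r]) auto
  have less: "?F s < ?F t" if "0 < s" "s < t" for s t
    using that assms by (intro mult_strict_mono power_strict_mono) (auto simp: add_nonneg_pos)
  show "s = t" if "s \<in> {0<..<1} \<and> ?F s = 1" "t \<in> {0<..<1} \<and> ?F t = 1" for s t
    using less[of s t] less[of t s] that by (cases s t rule: linorder_cases) auto
qed

text \<open>Vanishes at \<open>D = 0\<close>, where both numerator and denominator are zero.\<close>
definition bernoulli_quot :: "real \<Rightarrow> nat \<Rightarrow> real" where
  "bernoulli_quot \<rho> D = (\<rho> ^ Suc D - 1 - real (Suc D) * (\<rho> - 1)) / (real D * real (Suc D))"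

lemma bernoulli_second_order:
  fixes t :: real
  assumes "t \<ge> 0"
  shows "1 + real m * t + real m * (real m - 1) / 2 * t\<^sup>2 \<le> (1 + t) ^ m"
proof (induction m)
  case (Suc m)
  have "1 + real (Suc m) * t + real (Suc m) * (real (Suc m) - 1) / 2 * t\<^sup>2
      \<le> (1 + t) * (1 + real m * t + real m * (real m - 1) / 2 * t\<^sup>2)"
  proof -
    \<comment> \<open>This is exactly the amount by which the right-hand side exceeds the
      left.\<close>
    have "0 \<le> real m * (real m - 1) / 2 * t ^ 3"
      using assms by (cases m) auto
    then show ?thesis by (simp add: field_simps power2_eq_square power3_eq_cube)
  qed
  also have "\<dots> \<le> (1 + t) ^ Suc m" using Suc assms by (simp add: mult_left_mono)
  finally show ?case .
qed simp

text \<open>The first bound gives \<open>a \<le> y\<close> for the weights below, the second that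
  \<open>a\<close> increases. Both follow from the recurrence \<open>P_Suc\<close> for the
  numerators.\<close>

lemma bernoulli_quot_Suc:
  assumes "\<rho> \<ge> 1" "D \<ge> 1"
  shows "bernoulli_quot \<rho> D \<le> bernoulli_quot \<rho> (Suc D)"
    and "bernoulli_quot \<rho> (Suc D) \<le> \<rho> * bernoulli_quot \<rho> D"
proof -
  define t where "t = \<rho> - 1"
  have t: "t \<ge> 0" "\<rho> = 1 + t" using assms by (auto simp: t_def)
  define P where "P D = \<rho> ^ Suc D - 1 - real (Suc D) * t" for D
  have P_Suc: "P (Suc D) = \<rho> * P D + real (Suc D) * t\<^sup>2" for D
    by (simp add: P_def t(2) algebra_simps power2_eq_square)
  have P_nonneg: "P D \<ge> 0" for D
    by (induction D) (use P_Suc t in \<open>auto simp: P_def[of 0]\<close>)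
  \<comment> \<open>The first claim with denominators cleared.\<close>
  have K: "0 \<le> real D * P (Suc D) - real (D + 2) * P D" for D
  proof (induction D)
    case (Suc D)
    have "real (Suc D) * P (Suc (Suc D)) - real (Suc D + 2) * P (Suc D)
      = \<rho> * (real D * P (Suc D) - real (D + 2) * P D) + t * P (Suc D)"
      unfolding P_def t(2) by (simp add: algebra_simps power2_eq_square)
    then show ?case using Suc P_nonneg[of "Suc D"] t by simp
  qed (simp add: P_def t(2))
  have q: "bernoulli_quot \<rho> D = P D / (real D * real (Suc D))" for D
    by (simp add: bernoulli_quot_def P_def t_def)
  show "bernoulli_quot \<rho> D \<le> bernoulli_quot \<rho> (Suc D)"
    using K[of D] assms(2) by (simp add: q divide_simps) (simp add: algebra_simps)
  \<comment> \<open>By \<open>P_Suc\<close> the second claim amounts to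
    \<open>2 * \<rho> * P D \<ge> D * (D + 1) * t\<^sup>2\<close>, so the second-order bound
    suffices.\<close>
  have "0 \<le> P D - real D * real (Suc D) / 2 * t\<^sup>2"
    using bernoulli_second_order[OF t(1), of "Suc D"] by (simp add: P_def t(2) algebra_simps)
  then have "0 \<le> \<rho> * P D * real (D + 2) - real D * P (Suc D)"
    unfolding P_Suc using t by (simp add: algebra_simps) (smt (verit) mult_nonneg_nonneg P_nonneg)
  then show "bernoulli_quot \<rho> (Suc D) \<le> \<rho> * bernoulli_quot \<rho> D"
    using assms(2) by (simp add: q divide_simps) (simp add: algebra_simps)
qed

lemma bernoulli_quot_mono:
  assumes "\<rho> \<ge> 1" "1 \<le> D" "D \<le> E"
  shows "bernoulli_quot \<rho> D \<le> bernoulli_quot \<rho> E"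
  using assms(3)
proof (induction E rule: dec_induct)
  case (step m)
  then show ?case using bernoulli_quot_Suc(1)[OF assms(1), of m] assms(2) by linarith
qed simp

text \<open>
  The weight of \<open>d\<^sub>l\<close> will be \<open>y\<^bsub>l+1\<^esub> - a\<^bsub>l+1\<^esub>\<close> and that of \<open>\<Psi>\<^sub>l\<close> will be \<open>a\<^bsub>l+1\<^esub> - a\<^sub>l\<close>. The last two
  equations match the coefficients of \<open>\<parallel>g\<^sub>l\<parallel>\<^sup>2\<close> and of \<open>k\<^sub>l - k\<^sub>n\<close>.
\<close>
lemma certificate_weights:
  fixes r :: real
  assumes n: "n \<ge> 1" and r: "0 < r" "r < 1" and bal: "r ^ n * (1 + real n * (1 + r)) = 1"
  obtains y a :: "nat \<Rightarrow> real" where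
    "y 0 = 0" "a 0 = 0" "y n = real n / 2 * (1 + 1 / r ^ n)"
    "\<And>l. l < n \<Longrightarrow> a l \<le> a (Suc l)" "\<And>l. l < n \<Longrightarrow> a (Suc l) \<le> y (Suc l)"
    "\<And>l. r\<^sup>2 * y (Suc l) - y l = (1 - r) / 2"
    "\<And>l. l < n \<Longrightarrow> (1 + r) * (a (Suc l) * (real n - 1 - real l) - a l * (real n - real l + 1))
       + (1 - r) * (y (Suc l) - y l) = 1"
proof -
  define h where "h = 1 + r"
  define \<rho> where "\<rho> = 1 / r\<^sup>2"
  define H where "H = bernoulli_quot \<rho>"
  have h: "h > 1" using r by (simp add: h_def)
  have \<rho>: "\<rho> > 1" using r by (simp add: \<rho>_def abs_square_less_1)
  have \<rho>r: "\<rho> * r\<^sup>2 = 1" using r by (simp add: \<rho>_def)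
  have rn: "1 / r ^ n = 1 + real n * h"
    using bal r by (simp add: h_def field_simps)
  have \<rho>n: "\<rho> ^ n = (1 + real n * h)\<^sup>2"
    unfolding rn[symmetric] by (simp add: \<rho>_def power_divide power_mult[symmetric] mult.commute)
  have t: "\<rho> - 1 = \<rho> * (1 - r) * h"
    using \<rho>r by (simp add: h_def algebra_simps power2_eq_square)
  \<comment> \<open>The balance equation, in the form \<open>\<rho>n\<close>, fixes this value. It
    makes \<open>a 0\<close> vanish and turns monotonicity of \<open>H\<close> into
    \<open>a l \<le> y l\<close>.\<close>
  have Hn: "H n = \<rho> * h\<^sup>2"
  proof -
    have "\<rho> ^ Suc n - 1 - real (Suc n) * (\<rho> - 1)
      = \<rho> * (\<rho> ^ n - 1) - real n * (\<rho> - 1)" by (simp add: algebra_simps)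
    also have "\<dots> = \<rho> * ((1 + real n * h)\<^sup>2 - 1 - real n * ((1 - r) * h))"
      unfolding \<rho>n t by (simp add: algebra_simps)
    also have "(1 + real n * h)\<^sup>2 - 1 - real n * ((1 - r) * h) = real n * real (Suc n) * h\<^sup>2"
      by (simp add: h_def algebra_simps power2_eq_square)
    finally show ?thesis using n by (simp add: H_def bernoulli_quot_def)
  qed
  \<comment> \<open>The solution of the recurrence for \<open>y\<close> that starts at
    \<open>0\<close>.\<close>
  define y where "y l = (\<rho> ^ l - 1) / (2 * h)" for l
  \<comment> \<open>The last equation does not constrain \<open>a n\<close>, whose factor at
    \<open>l = n - 1\<close> is zero. The choice \<open>y n\<close> gives the final \<open>d\<close>
    weight zero.\<close>
  define a where "a l = (if l < n then (\<rho> ^ l * H (n - l) / \<rho> - h\<^sup>2) / (2 * h ^ 3) else y n)" for l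
  show ?thesis
  proof
    show "y 0 = 0" by (simp add: y_def)
    show "a 0 = 0" using n \<rho> by (simp add: a_def Hn)
    show "y n = real n / 2 * (1 + 1 / r ^ n)"
      unfolding y_def \<rho>n rn using h by (simp add: field_simps power2_eq_square)
    show "r\<^sup>2 * y (Suc l) - y l = (1 - r) / 2" for l
    proof -
      have "r\<^sup>2 * (\<rho> ^ Suc l - 1) - (\<rho> ^ l - 1) = 1 - r\<^sup>2"
        using \<rho>r by (simp add: algebra_simps)
      also have "\<dots> = (1 - r) * h" by (simp add: h_def algebra_simps power2_eq_square)
      finally have "r\<^sup>2 * (\<rho> ^ Suc l - 1) - (\<rho> ^ l - 1) = (1 - r) * h" .
      moreover have "r\<^sup>2 * y (Suc l) - y l = (r\<^sup>2 * (\<rho> ^ Suc l - 1) - (\<rho> ^ l - 1)) / (2 * h)"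
        by (simp add: y_def diff_divide_distrib right_diff_distrib)
      ultimately show ?thesis using h by simp
    qed
    have le_y: "a l \<le> y l" if "l \<le> n" for l
    proof (cases "l < n")
      case True
      have "H (n - l) \<le> H n"
        unfolding H_def using True \<rho> by (intro bernoulli_quot_mono) auto
      then have "\<rho> ^ l * H (n - l) / \<rho> - h\<^sup>2 \<le> h\<^sup>2 * (\<rho> ^ l - 1)"
        using \<rho> by (simp add: Hn field_simps)
      then have "a l \<le> h\<^sup>2 * (\<rho> ^ l - 1) / (2 * h ^ 3)"
        using True h by (simp add: a_def divide_right_mono)
      also have "\<dots> = y l" using h by (simp add: y_def power2_eq_square power3_eq_cube)
      finally show ?thesis .
    qed (use that in \<open>simp add: a_def\<close>)
    then show "a (Suc l) \<le> y (Suc l)" if "l < n" for l using that by simp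
    show "a l \<le> a (Suc l)" if "l < n" for l
    proof (cases "Suc l < n")
      case True
      have "H (Suc (n - Suc l)) \<le> \<rho> * H (n - Suc l)"
        unfolding H_def using True \<rho> by (intro bernoulli_quot_Suc(2)) auto
      moreover have "Suc (n - Suc l) = n - l" using that by simp
      ultimately have "\<rho> ^ l * H (n - l) / \<rho> - h\<^sup>2 \<le> \<rho> ^ Suc l * H (n - Suc l) / \<rho> - h\<^sup>2"
        using \<rho> by (simp add: field_simps)
      then show ?thesis using that True h by (simp add: a_def divide_right_mono)
    next
      case False
      then have "a (Suc l) = y n" by (simp add: a_def)
      moreover have "y l \<le> y n" using \<rho> h that by (simp add: y_def divide_right_mono power_increasing)
      ultimately show ?thesis using le_y[of l] that by simp
    qed
    show "(1 + r) * (a (Suc l) * (real n - 1 - real l) - a l * (real n - real l + 1))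
       + (1 - r) * (y (Suc l) - y l) = 1" if ln: "l < n" for l
    proof -
      obtain D where D: "n = l + Suc D" using less_imp_Suc_add[OF ln] by auto
      define P where "P D = \<rho> ^ Suc D - 1 - real (Suc D) * (\<rho> - 1)" for D
      \<comment> \<open>At \<open>D = 0\<close> both sides are zero, since \<open>P 0 = 0\<close>;
        otherwise the factor \<open>D\<close> cancels in the denominator of
        \<open>H D\<close>.\<close>
      have a1: "a (Suc l) * real D = (\<rho> ^ l * P D / real (Suc D) - h\<^sup>2 * real D) / (2 * h ^ 3)"
        using \<rho> h by (cases "D = 0")
          (simp_all add: a_def D H_def bernoulli_quot_def P_def[symmetric] P_def[of 0] divide_simps del: of_nat_Suc power_Suc, simp add: algebra_simps)
      have a0: "a l * real (Suc (Suc D)) = (\<rho> ^ l / \<rho> * P (Suc D) / real (Suc D) - h\<^sup>2 * real (Suc (Suc D))) / (2 * h ^ 3)"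
        using \<rho> h by (simp add: a_def D H_def bernoulli_quot_def P_def[symmetric] divide_simps del: of_nat_Suc power_Suc)
      \<comment> \<open>With this recurrence the \<open>P D\<close> terms cancel in the difference
        of \<open>a1\<close> and \<open>a0\<close>.\<close>
      have PP: "P (Suc D) = \<rho> * P D + real (Suc D) * (\<rho> - 1)\<^sup>2"
        by (simp add: P_def algebra_simps power2_eq_square)
      have "a (Suc l) * real D - a l * real (Suc (Suc D))
        = (2 * h\<^sup>2 - \<rho> ^ l / \<rho> * (\<rho> - 1)\<^sup>2) / (2 * h ^ 3)"
        unfolding a1 a0 PP using \<rho> h by (simp add: divide_simps del: of_nat_Suc) (simp add: algebra_simps)
      also have "\<rho> ^ l / \<rho> * (\<rho> - 1)\<^sup>2 = (1 - r) * h * (\<rho> ^ Suc l - \<rho> ^ l)"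
      proof -
        have sq: "(\<rho> - 1)\<^sup>2 = \<rho> * ((1 - r) * h * (\<rho> - 1))"
          using t by (simp add: power2_eq_square)
        show ?thesis unfolding sq using \<rho> by (simp add: algebra_simps)
      qed
      finally have diff: "a (Suc l) * real D - a l * real (Suc (Suc D))
        = (2 * h\<^sup>2 - (1 - r) * h * (\<rho> ^ Suc l - \<rho> ^ l)) / (2 * h ^ 3)" .
      have y_diff: "y (Suc l) - y l = (\<rho> ^ Suc l - \<rho> ^ l) / (2 * h)"
        by (simp add: y_def diff_divide_distrib)
      have "h * (a (Suc l) * real D - a l * real (Suc (Suc D))) = 1 - (1 - r) * (y (Suc l) - y l)"
        unfolding diff y_diff using h by (simp add: field_simps power2_eq_square power3_eq_cube)
      then show ?thesis by (simp add: D h_def algebra_simps)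
    qed
  qed
qed

section \<open>The inequality along the iteration\<close>

text \<open>The right-hand side is \<open>\<Psi>\<^sub>l\<close>, a nonnegative combination of the
  subgradient gaps \<open>e\<close>, after elimination of its inner products.\<close>

lemma convex_chain_endpoints:
  fixes p g :: "nat \<Rightarrow> 'a::real_inner" and k :: "nat \<Rightarrow> real"
  assumes step: "\<And>i. i < n \<Longrightarrow> p i - p (Suc i) = g (Suc i) + r *\<^sub>R g i"
    and sub: "\<And>i j. i \<le> n \<Longrightarrow> j \<le> n \<Longrightarrow> k j + g j \<bullet> (p i - p j) \<le> k i"
    and r: "0 \<le> r" and l: "l < n"
  shows "0 \<le> ((1 - r) + (1 + r) * (real n - 1 - real l)) * (k l - k n)
      - 2 * (1 + r) * (\<Sum>i=Suc l..<n. k i - k n)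
      + r\<^sup>2 * (norm (g l))\<^sup>2 - (1 - r\<^sup>2) * (\<Sum>i=Suc l..<n. (norm (g i))\<^sup>2) - (norm (g n))\<^sup>2"
    (is "0 \<le> ?R")
proof -
  define e where "e i j = k i - k j - g j \<bullet> (p i - p j)" for i j
  have e: "0 \<le> e i j" if "i \<le> n" "j \<le> n" for i j
    using sub[OF that] by (simp add: e_def)
  \<comment> \<open>In terms of \<open>x\<close> the sum of the \<open>g i \<bullet> p i\<close> telescopes, because \<open>x i - x (Suc i) = (1 + r) *\<^sub>R g i\<close>.\<close>
  define x where "x i = p i + g i" for i
  define q where "q = p l + p n"
  have x_Suc: "x (Suc i) = p i - r *\<^sub>R g i" if "i < n" for i
    using step[OF that] by (simp add: x_def algebra_simps)
  \<comment> \<open>Each summand is a difference of consecutive values of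
    \<open>x i \<bullet> q - x i \<bullet> x i\<close> plus a multiple of
    \<open>g i \<bullet> g i\<close>. The free end \<open>m\<close> is for the induction.\<close>
  have gram: "(\<Sum>i=Suc l..<m. (1 + r) * (g i \<bullet> (q - 2 *\<^sub>R p i)))
      = (x (Suc l) - x m) \<bullet> q - (x (Suc l) \<bullet> x (Suc l) - x m \<bullet> x m)
        + (1 - r\<^sup>2) * (\<Sum>i=Suc l..<m. g i \<bullet> g i)" if "Suc l \<le> m" "m \<le> n" for m
    using that
  proof (induction m rule: dec_induct)
    case (step m)
    then have x': "x (Suc m) = p m - r *\<^sub>R g m" by (intro x_Suc) simp
    have "x (Suc m) \<bullet> q = p m \<bullet> q - r * (g m \<bullet> q)" "x m \<bullet> q = p m \<bullet> q + g m \<bullet> q"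
      "x (Suc m) \<bullet> x (Suc m) = p m \<bullet> p m - 2 * r * (g m \<bullet> p m) + r\<^sup>2 * (g m \<bullet> g m)"
      "x m \<bullet> x m = p m \<bullet> p m + 2 * (g m \<bullet> p m) + g m \<bullet> g m"
      unfolding x' by (simp_all add: x_def inner_diff_left inner_diff_right inner_add_left inner_add_right
          inner_commute[of "p m" "g m"] power2_eq_square algebra_simps)
    with step show ?case
      by (simp add: inner_diff_left inner_diff_right) (simp add: algebra_simps power2_eq_square)
  qed simp
  define A where "A = (\<Sum>i=Suc l..<n. k i - k n)"
  define B where "B = (\<Sum>i=Suc l..<n. g i \<bullet> (q - 2 *\<^sub>R p i))"
  have "(\<Sum>i=Suc l..<n. e l i + e n i)
      = (\<Sum>i=Suc l..<n. (k l - k n) - 2 * (k i - k n) - g i \<bullet> (q - 2 *\<^sub>R p i))"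
    by (intro sum.cong) (simp_all add: e_def q_def inner_diff_right inner_add_right algebra_simps)
  also have "\<dots> = (real n - 1 - real l) * (k l - k n) - 2 * A - B"
    unfolding A_def B_def using l
    by (simp only: sum_subtractf sum_distrib_left[symmetric] sum_constant card_atLeastLessThan)
      (simp add: of_nat_diff algebra_simps)
  finally have mid: "(\<Sum>i=Suc l..<n. e l i + e n i) = \<dots>" .
  have ends: "e l n + r * e n l
      = (1 - r) * (k l - k n) + (r *\<^sub>R g l - g n) \<bullet> (p l - p n)"
    by (simp add: e_def inner_diff_left inner_diff_right algebra_simps)
  define C where "C = (\<Sum>i=Suc l..<n. g i \<bullet> g i)"
  have "(1 + r) * B = (x (Suc l) - x n) \<bullet> q - (x (Suc l) \<bullet> x (Suc l) - x n \<bullet> x n) + (1 - r\<^sup>2) * C"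
    using gram[of n] l by (simp add: B_def C_def sum_distrib_left)
  \<comment> \<open>The boundary terms reproduce the inner product in \<open>ends\<close>, so the
    two cancel in the weighted sum.\<close>
  also have "\<dots> = ((r *\<^sub>R g l - g n) \<bullet> (p l - p n)) + (1 - r\<^sup>2) * C
      - r\<^sup>2 * (g l \<bullet> g l) + g n \<bullet> g n"
    by (simp add: x_Suc[OF l] x_def[of n] q_def inner_diff_left inner_diff_right
          inner_add_left inner_add_right inner_commute power2_eq_square algebra_simps)
  finally have "?R = e l n + r * e n l + (1 + r) * (\<Sum>i=Suc l..<n. e l i + e n i)"
    unfolding mid ends A_def[symmetric] power2_norm_eq_inner C_def[symmetric] by (simp add: algebra_simps)
  also have "\<dots> \<ge> 0" using r l by (intro add_nonneg_nonneg mult_nonneg_nonneg sum_nonneg e) auto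
  finally show ?thesis .
qed

lemma abel_summation:
  fixes a \<Psi> :: "nat \<Rightarrow> 'a::comm_ring"
  assumes "a 0 = 0"
  shows "(\<Sum>l<m. (a (Suc l) - a l) * \<Psi> l) = (\<Sum>l<m. a (Suc l) * (\<Psi> l - \<Psi> (Suc l))) + a m * \<Psi> m"
  by (induction m) (use assms in \<open>simp_all add: algebra_simps\<close>)

text \<open>A weighted sum of the nonnegative \<open>d l\<close> and \<open>\<Psi> l\<close>; the
  relations from \<open>certificate_weights\<close> are what makes its coefficients match the
  claim.\<close>

lemma convex_chain_bound:
  fixes p g :: "nat \<Rightarrow> 'a::real_inner" and k :: "nat \<Rightarrow> real"
  assumes n: "n \<ge> 1" and r: "0 < r" "r < 1" and bal: "r ^ n * (1 + real n * (1 + r)) = 1"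
    and step: "\<And>i. i < n \<Longrightarrow> p i - p (Suc i) = g (Suc i) + r *\<^sub>R g i"
    and sub: "\<And>i j. i \<le> n \<Longrightarrow> j \<le> n \<Longrightarrow> k j + g j \<bullet> (p i - p j) \<le> k i"
  shows "real n / 2 * (1 + 1 / r ^ n) * (norm (g n))\<^sup>2
    \<le> (\<Sum>i<n. k i - k n + (1 - r) / 2 * (norm (g i))\<^sup>2)"
proof -
  obtain y a :: "nat \<Rightarrow> real" where
    y0: "y 0 = 0" and a0: "a 0 = 0" and yn: "y n = real n / 2 * (1 + 1 / r ^ n)"
    and a_mono: "\<And>l. l < n \<Longrightarrow> a l \<le> a (Suc l)" and a_le: "\<And>l. l < n \<Longrightarrow> a (Suc l) \<le> y (Suc l)"
    and y_rec: "\<And>l. r\<^sup>2 * y (Suc l) - y l = (1 - r) / 2"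
    and flux: "\<And>l. l < n \<Longrightarrow> (1 + r) * (a (Suc l) * (real n - 1 - real l) - a l * (real n - real l + 1))
       + (1 - r) * (y (Suc l) - y l) = 1"
    using certificate_weights[OF n r bal] by blast
  define K where "K i = k i - k n" for i
  define G where "G i = (norm (g i))\<^sup>2" for i
  define d where "d i = (1 - r) * (K i - K (Suc i)) - G (Suc i) + r\<^sup>2 * G i" for i
  \<comment> \<open>Chosen so that the expression in \<open>convex_chain_endpoints\<close> becomes
    the tail sum \<open>\<Psi> l\<close> of \<open>d i + c i\<close>; then
    \<open>\<Psi> n = 0\<close> and Abel summation leaves no boundary term.\<close>
  define c where "c i = (1 + r) * ((real n - 1 - real i) * K i - (real n - real i) * K (Suc i))" for i
  define \<Psi> where "\<Psi> l = (\<Sum>i=l..<n. d i + c i)" for l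
  have d_nonneg: "0 \<le> d l" if "l < n" for l
  proof -
    have "0 \<le> (K l - K (Suc l) - g (Suc l) \<bullet> (p l - p (Suc l)))
        + r * (K (Suc l) - K l - g l \<bullet> (p (Suc l) - p l))"
      using sub[of l "Suc l"] sub[of "Suc l" l] that r
      by (intro add_nonneg_nonneg mult_nonneg_nonneg) (auto simp: K_def)
    also have "p (Suc l) - p l = - (g (Suc l) + r *\<^sub>R g l)" using step[OF that] by (simp add: algebra_simps)
    finally show ?thesis
      unfolding step[OF that] d_def G_def power2_norm_eq_inner
      by (simp add: inner_add_right inner_commute power2_eq_square algebra_simps)
  qed
  have \<Psi>_nonneg: "0 \<le> \<Psi> l" if "l < n" for l
  proof -
    \<comment> \<open>At \<open>m = n\<close> the terms with \<open>K m\<close> drop out because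
      \<open>K n = 0\<close>.\<close>
    have "(\<Sum>i=l..<m. d i + c i) = (1 - r) * (K l - K m)
        + (1 + r) * ((real n - 1 - real l) * K l - (real n - real m + 1) * K m - 2 * (\<Sum>i=Suc l..<m. K i))
        + r\<^sup>2 * G l - G m - (1 - r\<^sup>2) * (\<Sum>i=Suc l..<m. G i)" if "Suc l \<le> m" for m
      using that
    proof (induction m rule: dec_induct)
      case base
      then show ?case by (simp add: d_def c_def algebra_simps)
    next
      case (step m)
      then show ?case by (simp add: d_def c_def algebra_simps)
    qed
    from this[of n] show ?thesis
      using convex_chain_endpoints[of n p g r k l, OF step sub] r that
      by (simp add: \<Psi>_def K_def G_def algebra_simps)
  qed
  have "0 \<le> (\<Sum>l<n. (y (Suc l) - a (Suc l)) * d l) + (\<Sum>l<n. (a (Suc l) - a l) * \<Psi> l)"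
    using a_mono a_le by (intro add_nonneg_nonneg sum_nonneg mult_nonneg_nonneg d_nonneg \<Psi>_nonneg) auto
  also have "(\<Sum>l<n. (a (Suc l) - a l) * \<Psi> l) = (\<Sum>l<n. a (Suc l) * (\<Psi> l - \<Psi> (Suc l)))"
    using abel_summation[where a = a and m = n and \<Psi> = \<Psi>, OF a0] by (simp add: \<Psi>_def)
  also have "\<dots> = (\<Sum>l<n. a (Suc l) * (d l + c l))"
    by (intro sum.cong) (simp_all add: \<Psi>_def sum.atLeast_Suc_lessThan)
  also have "(\<Sum>l<n. (y (Suc l) - a (Suc l)) * d l) + \<dots> = (\<Sum>l<n. y (Suc l) * d l + a (Suc l) * c l)"
    by (simp add: sum.distrib[symmetric] algebra_simps)
  also have "\<dots> = (\<Sum>l<m. K l + (1 - r) / 2 * G l) - y m * G m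
      - K m * ((1 + r) * a m * (real n - real m + 1) + (1 - r) * y m)" if "m = n" for m
  proof -
    \<comment> \<open>By \<open>flux\<close> and \<open>y_rec\<close> every completed index has its
      final coefficients; the last two terms are the carry, whose \<open>K\<close> part vanishes at
      \<open>m = n\<close>.\<close>
    have "(\<Sum>l<m. y (Suc l) * d l + a (Suc l) * c l) = (\<Sum>l<m. K l + (1 - r) / 2 * G l) - y m * G m
      - K m * ((1 + r) * a m * (real n - real m + 1) + (1 - r) * y m)" if "m \<le> n" for m
      using that
    proof (induction m)
      case (Suc m)
      have "y (Suc m) * d m + a (Suc m) * c m
        = K m * ((1 + r) * (a (Suc m) * (real n - 1 - real m) - a m * (real n - real m + 1))
            + (1 - r) * (y (Suc m) - y m)) + (r\<^sup>2 * y (Suc m) - y m) * G m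
          + y m * G m + K m * ((1 + r) * a m * (real n - real m + 1) + (1 - r) * y m)
          - y (Suc m) * G (Suc m)
          - K (Suc m) * ((1 + r) * a (Suc m) * (real n - real (Suc m) + 1) + (1 - r) * y (Suc m))"
        unfolding d_def c_def by (simp add: algebra_simps)
      also have "\<dots> = K m + (1 - r) / 2 * G m
          + y m * G m + K m * ((1 + r) * a m * (real n - real m + 1) + (1 - r) * y m)
          - y (Suc m) * G (Suc m)
          - K (Suc m) * ((1 + r) * a (Suc m) * (real n - real (Suc m) + 1) + (1 - r) * y (Suc m))"
        using flux[of m] Suc.prems y_rec[of m] by simp
      finally show ?case using Suc by simp
    qed (simp add: y0 a0)
    then show ?thesis using that by simp
  qed
  finally show ?thesis by (simp add: K_def G_def yn)
qed

text \<open>The case \<open>L = 1\<close>, for abstract values at the iterates. The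
  \<open>star\<close> inequalities bring in \<open>z\<close>, and their sum telescopes into squared
  distances.\<close>

lemma gradient_descent_balanced_rate:
  fixes x g :: "nat \<Rightarrow> 'a::real_inner" and f :: "nat \<Rightarrow> real"
  assumes n: "n \<ge> 1" and r: "0 < r" "r < 1" and bal: "r ^ n * (1 + real n * (1 + r)) = 1"
    and step: "\<And>i. i < n \<Longrightarrow> x (Suc i) = x i - (1 + r) *\<^sub>R g i"
    and interp: "\<And>i j. i \<le> n \<Longrightarrow> j \<le> n \<Longrightarrow>
      f j + g j \<bullet> (x i - x j) + (norm (g i - g j))\<^sup>2 / 2 \<le> f i"
    and star: "\<And>i. i < n \<Longrightarrow> f i + g i \<bullet> (z - x i) + (norm (g i))\<^sup>2 / 2 \<le> v"
  shows "(1 - r ^ n) / 2 * (norm (g n))\<^sup>2 + (r ^ n)\<^sup>2 / 2 * (norm (x n - z))\<^sup>2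
      + (r ^ n - (r ^ n)\<^sup>2) * (f n - v) \<le> (r ^ n)\<^sup>2 / 2 * (norm (x 0 - z))\<^sup>2"
proof -
  define \<eta> where "\<eta> = r ^ n"
  have \<eta>: "\<eta> > 0" "1 - \<eta> = \<eta> * (real n * (1 + r))" using r bal by (auto simp: \<eta>_def algebra_simps)
  have "real n / 2 * (1 + 1 / \<eta>) * (norm (g n))\<^sup>2
    \<le> (\<Sum>i<n. (f i - (norm (g i))\<^sup>2 / 2) - (f n - (norm (g n))\<^sup>2 / 2) + (1 - r) / 2 * (norm (g i))\<^sup>2)"
    unfolding \<eta>_def
  proof (rule convex_chain_bound[OF n r bal, where p = "\<lambda>i. x i - g i"])
    show "x i - g i - (x (Suc i) - g (Suc i)) = g (Suc i) + r *\<^sub>R g i" if "i < n" for i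
      using step[OF that] by (simp add: algebra_simps)
    show "f j - (norm (g j))\<^sup>2 / 2 + g j \<bullet> (x i - g i - (x j - g j)) \<le> f i - (norm (g i))\<^sup>2 / 2"
      if "i \<le> n" "j \<le> n" for i j
      using interp[OF that]
      by (simp add: power2_norm_eq_inner inner_diff_left inner_diff_right inner_commute
          diff_divide_distrib add_divide_distrib algebra_simps)
  qed
  also have "\<dots> = (\<Sum>i<n. (f i - f n - r / 2 * (norm (g i))\<^sup>2) + (norm (g n))\<^sup>2 / 2)"
    by (intro sum.cong) (simp_all add: field_simps)
  also have "\<dots> = (\<Sum>i<n. f i - f n - r / 2 * (norm (g i))\<^sup>2) + real n / 2 * (norm (g n))\<^sup>2"
    unfolding sum.distrib by simp
  also have "real n / 2 * (1 + 1 / \<eta>) * (norm (g n))\<^sup>2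
      = real n / (2 * \<eta>) * (norm (g n))\<^sup>2 + real n / 2 * (norm (g n))\<^sup>2"
    using \<eta> by (simp add: field_simps)
  finally have "real n / (2 * \<eta>) * (norm (g n))\<^sup>2 \<le> (\<Sum>i<n. f i - f n - r / 2 * (norm (g i))\<^sup>2)"
    by simp
  also have "\<dots> \<le> (\<Sum>i<n. v - f n - g i \<bullet> (z - x i) - (1 + r) / 2 * (norm (g i))\<^sup>2)"
  proof (rule sum_mono)
    fix i assume "i \<in> {..<n}"
    then show "f i - f n - r / 2 * (norm (g i))\<^sup>2
        \<le> v - f n - g i \<bullet> (z - x i) - (1 + r) / 2 * (norm (g i))\<^sup>2"
      using star[of i] by (simp add: field_simps)
  qed
  finally have "(1 + r) * (real n / (2 * \<eta>) * (norm (g n))\<^sup>2)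
      \<le> (1 + r) * (\<Sum>i<n. v - f n - g i \<bullet> (z - x i) - (1 + r) / 2 * (norm (g i))\<^sup>2)"
    using r by (intro mult_left_mono) auto
  also have "\<dots> = real n * (1 + r) * (v - f n) + (norm (x 0 - z))\<^sup>2 / 2 - (norm (x n - z))\<^sup>2 / 2"
  proof -
    \<comment> \<open>Expanding \<open>norm (x (Suc m) - z)\<close> turns the gradient terms of one
      summand into half the decrease of the squared distance.\<close>
    have "(1 + r) * (\<Sum>i<m. v - f n - g i \<bullet> (z - x i) - (1 + r) / 2 * (norm (g i))\<^sup>2)
        = real m * (1 + r) * (v - f n) + (norm (x 0 - z))\<^sup>2 / 2 - (norm (x m - z))\<^sup>2 / 2" if "m \<le> n" for m
      using that
    proof (induction m)
      case (Suc m)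
      have x_Suc: "x (Suc m) = x m - (1 + r) *\<^sub>R g m" using step[of m] Suc.prems by simp
      have "(norm (x (Suc m) - z))\<^sup>2 = (norm (x m - z))\<^sup>2 + 2 * (1 + r) * (g m \<bullet> (z - x m))
          + (1 + r)\<^sup>2 * (norm (g m))\<^sup>2"
        unfolding power2_norm_eq_inner x_Suc
        by (simp add: inner_diff_left inner_diff_right inner_commute power2_eq_square algebra_simps)
      with Suc show ?case by (simp add: algebra_simps power2_eq_square add_divide_distrib)
    qed simp
    then show ?thesis by simp
  qed
  finally have "\<eta>\<^sup>2 * ((1 + r) * (real n / (2 * \<eta>) * (norm (g n))\<^sup>2))
    \<le> \<eta>\<^sup>2 * (real n * (1 + r) * (v - f n) + (norm (x 0 - z))\<^sup>2 / 2 - (norm (x n - z))\<^sup>2 / 2)"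
    by (intro mult_left_mono) auto
  moreover have "\<eta>\<^sup>2 * ((1 + r) * (real n / (2 * \<eta>) * (norm (g n))\<^sup>2)) = (1 - \<eta>) / 2 * (norm (g n))\<^sup>2"
    using \<eta> by (simp add: power2_eq_square)
  moreover have "\<eta>\<^sup>2 * (real n * (1 + r) * (v - f n) + (norm (x 0 - z))\<^sup>2 / 2 - (norm (x n - z))\<^sup>2 / 2)
      = \<eta>\<^sup>2 / 2 * (norm (x 0 - z))\<^sup>2 - \<eta>\<^sup>2 / 2 * (norm (x n - z))\<^sup>2 - (\<eta> - \<eta>\<^sup>2) * (f n - v)"
  proof -
    have "\<eta> - \<eta>\<^sup>2 = \<eta> * (1 - \<eta>)" by (simp add: power2_eq_square right_diff_distrib)
    also have "\<dots> = \<eta>\<^sup>2 * (real n * (1 + r))" unfolding \<eta>(2) by (simp add: power2_eq_square)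
    finally show ?thesis by (simp only:) (simp add: algebra_simps)
  qed
  ultimately show ?thesis unfolding \<eta>_def[symmetric] by linarith
qed

theorem corollary5p1:
  fixes n :: nat and L :: real and f :: "real ^ 'd \<Rightarrow> real" and xstar :: "real ^ 'd"
  assumes "n \<ge> 1" and "L > 0"
    and "convex_on UNIV f" and "L_smooth L f"
    and "is_arg_min f (\<lambda>_. True) xstar"
  shows "(\<exists>!r::real. r \<in> {0<..<1} \<and> r ^ n * (1 + real n * (1 + r)) = 1) \<and>
    (\<forall>r \<in> {0<..<1}. r ^ n * (1 + real n * (1 + r)) = 1 \<longrightarrow>
      (\<forall>x :: nat \<Rightarrow> real ^ 'd.
        (\<forall>i<n. x (Suc i) = x i - ((1 + r) / L) *\<^sub>R gradient f (x i)) \<longrightarrow>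
        (let \<eta> = r ^ n in
          \<eta> = inverse (1 + real n * (1 + r)) \<and>
          (1 - \<eta>) / (2 * L) * (norm (gradient f (x n)))\<^sup>2
            + \<eta>\<^sup>2 * L / 2 * (norm (x n - xstar))\<^sup>2
            + (\<eta> - \<eta>\<^sup>2) * (f (x n) - f xstar)
          \<le> \<eta>\<^sup>2 * L / 2 * (norm (x 0 - xstar))\<^sup>2)))"
proof (intro conjI ballI impI allI)
  show "\<exists>!r::real. r \<in> {0<..<1} \<and> r ^ n * (1 + real n * (1 + r)) = 1"
    using \<open>n \<ge> 1\<close> by (rule ex1_balanced_ratio)
next
  fix r :: real and x :: "nat \<Rightarrow> real ^ 'd"
  assume r: "r \<in> {0<..<1}" and bal: "r ^ n * (1 + real n * (1 + r)) = 1"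
    and step: "\<forall>i<n. x (Suc i) = x i - ((1 + r) / L) *\<^sub>R gradient f (x i)"
  have L: "L > 0" by fact
  \<comment> \<open>Passing to \<open>f / L\<close> normalizes the smoothness constant to
    \<open>1\<close> and the step size to \<open>1 + r\<close>.\<close>
  define g where "g i = (1 / L) *\<^sub>R gradient f (x i)" for i
  have interp: "f u / L + ((1 / L) *\<^sub>R gradient f u) \<bullet> (w - u)
      + (norm ((1 / L) *\<^sub>R gradient f w - (1 / L) *\<^sub>R gradient f u))\<^sup>2 / 2 \<le> f w / L" for u w
  proof -
    have "(f u + gradient f u \<bullet> (w - u) + (norm (gradient f w - gradient f u))\<^sup>2 / (2 * L)) / L \<le> f w / L"
      using L_smooth_convex_interpolation[OF L assms(3,4)] L by (intro divide_right_mono) auto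
    then show ?thesis
      using L by (simp add: scaleR_diff_right[symmetric] power_mult_distrib power2_eq_square
          add_divide_distrib mult_ac)
  qed
  have min: "f xstar \<le> f w" for w
    using assms(5) by (simp add: is_arg_min_def not_less)
  have rate: "(1 - r ^ n) / 2 * (norm (g n))\<^sup>2 + (r ^ n)\<^sup>2 / 2 * (norm (x n - xstar))\<^sup>2
      + (r ^ n - (r ^ n)\<^sup>2) * (f (x n) / L - f xstar / L) \<le> (r ^ n)\<^sup>2 / 2 * (norm (x 0 - xstar))\<^sup>2"
  proof (rule gradient_descent_balanced_rate[OF \<open>n \<ge> 1\<close> _ _ bal, where f = "\<lambda>i. f (x i) / L"])
    show "x (Suc i) = x i - (1 + r) *\<^sub>R g i" if "i < n" for i
      using step that by (simp add: g_def)
    show "f (x j) / L + g j \<bullet> (x i - x j) + (norm (g i - g j))\<^sup>2 / 2 \<le> f (x i) / L" for i j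
      unfolding g_def by (rule interp)
    show "f (x i) / L + g i \<bullet> (xstar - x i) + (norm (g i))\<^sup>2 / 2 \<le> f xstar / L" for i
      using interp[of "x i" xstar] L_smooth_gradient_arg_min[OF L assms(4) min] by (simp add: g_def)
  qed (use r in auto)
  have grad: "(norm (gradient f (x n)))\<^sup>2 = L * (L * (norm (g n))\<^sup>2)"
    using L by (simp add: g_def power_divide power2_eq_square)
  have gap: "f (x n) - f xstar = L * (f (x n) / L - f xstar / L)"
    using L by (simp add: right_diff_distrib)
  have "(1 - r ^ n) / (2 * L) * (norm (gradient f (x n)))\<^sup>2
      + (r ^ n)\<^sup>2 * L / 2 * (norm (x n - xstar))\<^sup>2 + (r ^ n - (r ^ n)\<^sup>2) * (f (x n) - f xstar)
      = L * ((1 - r ^ n) / 2 * (norm (g n))\<^sup>2 + (r ^ n)\<^sup>2 / 2 * (norm (x n - xstar))\<^sup>2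
      + (r ^ n - (r ^ n)\<^sup>2) * (f (x n) / L - f xstar / L))"
    unfolding grad gap using L by (simp add: distrib_left mult_ac)
  also have "\<dots> \<le> L * ((r ^ n)\<^sup>2 / 2 * (norm (x 0 - xstar))\<^sup>2)"
    using rate L by (intro mult_left_mono) auto
  finally have "(1 - r ^ n) / (2 * L) * (norm (gradient f (x n)))\<^sup>2
      + (r ^ n)\<^sup>2 * L / 2 * (norm (x n - xstar))\<^sup>2 + (r ^ n - (r ^ n)\<^sup>2) * (f (x n) - f xstar)
      \<le> (r ^ n)\<^sup>2 * L / 2 * (norm (x 0 - xstar))\<^sup>2"
    by (simp add: mult_ac)
  moreover have "r ^ n = inverse (1 + real n * (1 + r))"
    using bal by (metis inverse_unique mult.commute)
  ultimately show "let \<eta> = r ^ n in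
      \<eta> = inverse (1 + real n * (1 + r)) \<and>
      (1 - \<eta>) / (2 * L) * (norm (gradient f (x n)))\<^sup>2
        + \<eta>\<^sup>2 * L / 2 * (norm (x n - xstar))\<^sup>2
        + (\<eta> - \<eta>\<^sup>2) * (f (x n) - f xstar)
      \<le> \<eta>\<^sup>2 * L / 2 * (norm (x 0 - xstar))\<^sup>2"
    unfolding Let_def by blast
qed

end
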